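(* For every integer $n\ge 1$, $$\mathrm{pf}_n(132,213)=\mathrm{pf}_n(132,312)=\mathrm{pf}_n(213,231)=\mathrm{pf}_n(231,312).$$ Furthermore, with the convention $\mathrm{pf}_0(132,213)=1$, for every integer $n\ge 1$, $$\mathrm{pf}_n(132,213)=\mathrm{pf}_{n-1}(132,213)+2\sum_{i=1}^{n-1}\mathrm{pf}_i(132,213)\,\mathrm{pf}_{n-i-1}(132,213).$$
   Context: A Dyck path of semilength $n$ is a lattice path from $(0,0)$ to $(n,n)$ consisting of $n$ north steps $N=(0,1)$ and $n$ east steps $E=(1,0)$ that never goes below the line $y=x$. A parking function of size $n$ is a Dyck path of semilength $n$ whose $n$ north steps are labeled bijectively by $\{1,\dots,n\}$ so that whenever two north steps are consecutive in the path (one immediately following the other), the label of the later one is larger. For a parking function $p$ of size $n$, $\phi(p)$ is the permutation of $\{1,\dots,n\}$ (in one-line notation) obtained by reading the labels of the north steps in the order they occur along the path. A permutation $\pi$ of $\{1,\dots,n\}$ contains a permutation $\rho$ of $\{1,\dots,m\}$ if there are indices $1\le i_1<\cdots<i_m\le n$ such that $\pi_{i_a}\le\pi_{i_b}$ if and only if $\rho_a\le\rho_b$; otherwise $\pi$ avoids $\rho$. For permutations $\rho_1,\dots,\rho_r$, $\mathrm{pf}_n(\rho_1,\dots,\rho_r)$ denotes the number of parking functions $p$ of size $n$ such that $\phi(p)$ avoids each of $\rho_1,\dots,\rho_r$. *)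

theory Defs
  imports Main
begin

datatype step = N | E

text \<open>The path starts at the origin, so after a prefix \<open>take k w\<close> it is at the point
  (number of \<open>E\<close>, number of \<open>N\<close>).\<close>

definition dyck_path :: "nat \<Rightarrow> step list \<Rightarrow> bool" where
  "dyck_path n w \<longleftrightarrow>
     count_list w N = n \<and> count_list w E = n \<and>
     (\<forall>k \<le> length w. count_list (take k w) E \<le> count_list (take k w) N)"

datatype labelled_step = North nat | East

primrec step_of :: "labelled_step \<Rightarrow> step" where
  "step_of (North a) = N"
| "step_of East = E"

primrec labels :: "labelled_step list \<Rightarrow> nat list" where
  "labels [] = []"
| "labels (s # p) = (case s of North a \<Rightarrow> a # labels p | East \<Rightarrow> labels p)"

definition parking_function :: "nat \<Rightarrow> labelled_step list \<Rightarrow> bool" where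
  "parking_function n p \<longleftrightarrow>
     dyck_path n (map step_of p) \<and>
     distinct (labels p) \<and> set (labels p) = {1..n} \<and>
     (\<forall>k a b. Suc k < length p \<longrightarrow> p ! k = North a \<longrightarrow> p ! Suc k = North b \<longrightarrow> a < b)"

text \<open>Permutations are lists in one-line notation (positions counted from 0), so
  \<open>labels p\<close> is the permutation \<open>\<phi>(p)\<close>.\<close>

definition contains :: "nat list \<Rightarrow> nat list \<Rightarrow> bool" where
  "contains \<pi> \<rho> \<longleftrightarrow>
     (\<exists>f :: nat \<Rightarrow> nat. strict_mono_on {..<length \<rho>} f \<and>
        (\<forall>a < length \<rho>. f a < length \<pi>) \<and>
        (\<forall>a < length \<rho>. \<forall>b < length \<rho>. \<pi> ! f a \<le> \<pi> ! f b \<longleftrightarrow> \<rho> ! a \<le> \<rho> ! b))"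

abbreviation avoids :: "nat list \<Rightarrow> nat list \<Rightarrow> bool" where
  "avoids \<pi> \<rho> \<equiv> \<not> contains \<pi> \<rho>"

definition pf :: "nat \<Rightarrow> nat list set \<Rightarrow> nat" where
  "pf n R = card {p. parking_function n p \<and> (\<forall>\<rho>\<in>R. avoids (labels p) \<rho>)}"

lemma length_steps: "length w = count_list w N + count_list w E"
  by (induction w) (auto intro: step.exhaust)

lemma North_in_set_labels: "North a \<in> set p \<Longrightarrow> a \<in> set (labels p)"
  by (induction p) (auto split: labelled_step.splits)

lemma finite_parking_functions: "finite {p. parking_function n p}"
proof (rule finite_subset)
  let ?S = "insert East (North ` {1..n})"
  show "{p. parking_function n p} \<subseteq> {p. set p \<subseteq> ?S \<and> length p = 2 * n}"
  proof safe
    fix p s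
    assume p: "parking_function n p"
    then show "length p = 2 * n"
      using length_steps[of "map step_of p"]
      by (simp add: parking_function_def dyck_path_def)
    assume "s \<in> set p" "s \<notin> North ` {1..n}"
    moreover have "set (labels p) = {1..n}"
      using p by (simp add: parking_function_def)
    ultimately show "s = East"
      using North_in_set_labels by (metis image_eqI labelled_step.exhaust)
  qed
  show "finite {p. set p \<subseteq> ?S \<and> length p = 2 * n}"
    by (rule finite_lists_length_eq) simp
qed

text \<open>The usual convention at size 0 holds for this definition: only the empty path is counted.\<close>

lemma pf_0:
  assumes "[] \<notin> R"
  shows "pf 0 R = 1"
proof -
  have "parking_function 0 p \<longleftrightarrow> p = []" for p
    using length_steps[of "map step_of p"]
    by (auto simp: parking_function_def dyck_path_def)
  moreover have "avoids [] \<rho>" if "\<rho> \<in> R" for \<rho>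
    using that assms by (auto simp: contains_def)
  ultimately have "{p. parking_function 0 p \<and> (\<forall>\<rho>\<in>R. avoids (labels p) \<rho>)} = {[]}"
    by auto
  then show ?thesis
    by (simp add: pf_def)
qed

end

(* A parking function is a Dyck path together with the word of its labels, and a word of labels fits a
   path iff each of its descents sits at a valley EN of the path. In each of the four avoidance
   classes every subset of {1..n-1} is the descent set of exactly one permutation: a permutation
   avoiding 213 and 231 takes at each place the least or the greatest remaining entry, one avoiding
   132 and 213 is a sequence of runs of consecutive values, the runs decreasing, and the other two
   classes are the reversals of these. Hence all four numbers are the sum of 2^(number of valleys)
   over the Dyck paths. In the first-return decomposition N u E v the valleys are those of u and v,
   and one more unless v is empty; this gives the recurrence. *)

theory Submission
  imports Defs
begin

section \<open>First-return decomposition of Dyck words\<close>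

text \<open>Tails of a Dyck word start at a positive height, so the recursion carries the height:
  the path starts at \<open>h\<close> and ends at 0. Dyck words are the case
  \<open>h = 0\<close>.\<close>

fun descends :: "nat \<Rightarrow> step list \<Rightarrow> bool" where
  "descends h [] \<longleftrightarrow> h = 0"
| "descends h (N # w) \<longleftrightarrow> descends (Suc h) w"
| "descends h (E # w) \<longleftrightarrow> (case h of 0 \<Rightarrow> False | Suc h' \<Rightarrow> descends h' w)"

lemma all_le_Suc_iff: "(\<forall>k \<le> Suc n. P k) \<longleftrightarrow> P 0 \<and> (\<forall>k \<le> n. P (Suc k))"
  by (metis Suc_le_mono not0_implies_Suc zero_le)

lemma descends_iff:
  "descends h w \<longleftrightarrow> h + count_list w N = count_list w E \<and>
     (\<forall>k \<le> length w. count_list (take k w) E \<le> h + count_list (take k w) N)"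
proof (induction h w rule: descends.induct)
  case (3 h w)
  then show ?case
    by (cases h) (auto simp: all_le_Suc_iff simp del: all_simps)
qed (auto simp: all_le_Suc_iff)

lemma dyck_path_iff: "dyck_path n w \<longleftrightarrow> descends 0 w \<and> count_list w N = n"
  by (auto simp: dyck_path_def descends_iff)

lemma descends_append: "descends h u \<Longrightarrow> descends h' v \<Longrightarrow> descends (h + h') (u @ v)"
  by (induction h u rule: descends.induct) (auto split: nat.splits)

text \<open>After \<open>u\<close> the path is at height 0, so a further \<open>E\<close> takes it
  below.\<close>

lemma not_descends_append_E: "descends h u \<Longrightarrow> \<not> descends h (u @ E # v)"
  by (induction h u rule: descends.induct) (auto split: nat.splits)

text \<open>The cut is at the first step from height \<open>h + 1\<close> down to \<open>h\<close>;
  until then the path stays at or above its starting height.\<close>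

lemma descends_Suc_decomp:
  "descends (Suc h) w \<Longrightarrow> \<exists>u v. w = u @ E # v \<and> descends 0 u \<and> descends h v"
proof (induction w arbitrary: h rule: length_induct)
  case (1 w)
  show ?case
  proof (cases w)
    case Nil
    then show ?thesis using 1 by simp
  next
    case (Cons s w')
    show ?thesis
    proof (cases s)
      case E
      then show ?thesis
        using 1(2) Cons by (intro exI[of _ "[]"] exI[of _ w']) simp
    next
      case N
      then have "descends (Suc (Suc h)) w'"
        using 1(2) Cons by simp
      \<comment> \<open>\<open>w'\<close> starts at height \<open>h + 2\<close>: the induction
        hypothesis cuts it at the first descent to \<open>h + 1\<close>, and then \<open>v\<close>
        at the first descent to \<open>h\<close>. The use on \<open>v\<close> is why the induction
        is on the length.\<close>
      then obtain u v where uv: "w' = u @ E # v" "descends 0 u" "descends (Suc h) v"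
        using 1(1)[rule_format, of w' "Suc h"] Cons by auto
      then obtain u' v' where uv': "v = u' @ E # v'" "descends 0 u'" "descends h v'"
        using 1(1)[rule_format, of v h] Cons by auto
      have "descends (0 + 1) (u @ E # u')"
        using uv uv' by (intro descends_append) auto
      then show ?thesis
        using uv uv' Cons N by (intro exI[of _ "N # u @ E # u'"] exI[of _ v']) simp
    qed
  qed
qed

text \<open>If \<open>u\<close> and \<open>u'\<close> differed, the longer one would continue the
  shorter one by an \<open>E\<close> at height 0.\<close>

lemma descends_first_return_unique:
  assumes "descends 0 u" "descends 0 u'" "u @ E # v = u' @ E # v'"
  shows "u = u' \<and> v = v'"
proof -
  from assms(3) obtain us where
    "(u = u' @ us \<and> us @ E # v = E # v') \<or> (u @ us = u' \<and> E # v = us @ E # v')"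
    by (auto simp: append_eq_append_conv2)
  then show ?thesis
    using assms not_descends_append_E by (cases us) auto
qed

lemma finite_dyck_paths: "finite {w. dyck_path n w}"
proof (rule finite_subset)
  show "{w. dyck_path n w} \<subseteq> {w. set w \<subseteq> {N, E} \<and> length w = 2 * n}"
    using step.exhaust by (auto simp: length_steps dyck_path_def)
qed (simp add: finite_lists_length_eq)

lemma dyck_path_0_iff: "dyck_path 0 w \<longleftrightarrow> w = []"
  using length_steps[of w] by (auto simp: dyck_path_def)

lemma bij_betw_first_return:
  "bij_betw (\<lambda>(i, u, v). N # u @ E # v)
     (SIGMA i:{..n}. {u. dyck_path i u} \<times> {v. dyck_path (n - i) v}) {w. dyck_path (Suc n) w}"
  (is "bij_betw ?f ?A _")
proof (intro bij_betw_imageI set_eqI iffI)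
  show "inj_on ?f ?A"
    using descends_first_return_unique by (auto simp: inj_on_def dyck_path_iff)
next
  fix w assume "w \<in> ?f ` ?A"
  then obtain i u v where w: "w = N # u @ E # v" "i \<le> n" "dyck_path i u" "dyck_path (n - i) v"
    by auto
  then have "descends (0 + 1) (u @ E # v)"
    by (intro descends_append) (auto simp: dyck_path_iff)
  then show "w \<in> {w. dyck_path (Suc n) w}"
    using w by (auto simp: dyck_path_iff)
next
  fix w assume "w \<in> {w. dyck_path (Suc n) w}"
  then have w: "descends 0 w" "count_list w N = Suc n"
    by (auto simp: dyck_path_iff)
  then obtain w' where w': "w = N # w'" "descends 1 w'"
    by (cases w; cases "hd w") auto
  then obtain u v where uv: "w' = u @ E # v" "descends 0 u" "descends 0 v"
    using descends_Suc_decomp[of 0 w'] by auto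
  then show "w \<in> ?f ` ?A"
    using w w' by (intro image_eqI[of _ _ "(count_list u N, u, v)"]) (auto simp: dyck_path_iff)
qed

section \<open>Valleys and the weighted sum over Dyck paths\<close>

text \<open>In a word beginning with \<open>N\<close> there is one entry for each two successive
  north steps, \<open>True\<close> if some \<open>E\<close> separates them, that is, at a valley.
  The entries thus line up with the adjacent pairs of labels.\<close>

fun gaps :: "step list \<Rightarrow> bool list" where
  "gaps (s # N # w) = (s = E) # gaps (N # w)"
| "gaps (s # E # w) = gaps (E # w)"
| "gaps _ = []"

abbreviation valleys :: "step list \<Rightarrow> nat" where
  "valleys w \<equiv> count_list (gaps w) True"

text \<open>A valley is an \<open>E\<close> followed by an \<open>N\<close>, so a cut just before an
  \<open>E\<close> destroys none.\<close>

lemma valleys_append_E: "valleys (u @ E # v) = valleys u + valleys (E # v)"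
proof (induction u rule: gaps.induct)
  case ("3_2" s)
  then show ?case by (cases s) auto
qed auto

lemma valleys_N: "valleys (N # u) = valleys u"
  by (cases u; cases "hd u") auto

lemma valleys_first_return:
  assumes "descends 0 v"
  shows "valleys (N # u @ E # v) = valleys u + valleys v + (if v = [] then 0 else 1)"
proof -
  \<comment> \<open>At height 0 a nonempty \<open>v\<close> must begin with \<open>N\<close>, which
    forms a valley with the \<open>E\<close> before it.\<close>
  have "valleys (E # v) = valleys v + (if v = [] then 0 else 1)"
    using assms by (cases v; cases "hd v") auto
  then show ?thesis
    by (simp add: valleys_N valleys_append_E)
qed

definition valley_sum :: "nat \<Rightarrow> nat" where
  "valley_sum n = (\<Sum>w | dyck_path n w. 2 ^ valleys w)"

lemma valley_sum_0: "valley_sum 0 = 1"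
  by (simp add: valley_sum_def dyck_path_0_iff)

lemma valley_sum_Suc:
  "valley_sum (Suc n) = valley_sum n + 2 * (\<Sum>i<n. valley_sum i * valley_sum (n - i))"
proof -
  have inner: "(\<Sum>(u, v)\<in>{u. dyck_path i u} \<times> {v. dyck_path (n - i) v}. (2::nat) ^ valleys (N # u @ E # v))
      = (if i = n then 1 else 2) * (valley_sum i * valley_sum (n - i))" if "i \<le> n" for i
  proof -
    have weight: "(2::nat) ^ valleys (N # u @ E # v) = (if i = n then 1 else 2) * (2 ^ valleys u * 2 ^ valleys v)"
      if "dyck_path (n - i) v" for u v
    proof -
      have "v = [] \<longleftrightarrow> i = n"
        using that \<open>i \<le> n\<close> dyck_path_0_iff[of v] by (auto simp: dyck_path_iff)
      then show ?thesis
        using that by (simp add: valleys_first_return dyck_path_iff power_add)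
    qed
    have "(\<Sum>(u, v)\<in>{u. dyck_path i u} \<times> {v. dyck_path (n - i) v}. (2::nat) ^ valleys (N # u @ E # v))
      = (\<Sum>(u, v)\<in>{u. dyck_path i u} \<times> {v. dyck_path (n - i) v}.
           (if i = n then 1 else 2) * (2 ^ valleys u * 2 ^ valleys v))"
      using weight by (intro sum.cong) auto
    also have "\<dots> = (if i = n then 1 else 2) * (valley_sum i * valley_sum (n - i))"
      unfolding split_def sum_distrib_left[symmetric]
      by (simp only: valley_sum_def sum_product sum.cartesian_product split_def)
    finally show ?thesis .
  qed
  have "valley_sum (Suc n) =
      (\<Sum>(i, u, v)\<in>(SIGMA i:{..n}. {u. dyck_path i u} \<times> {v. dyck_path (n - i) v}).
        2 ^ valleys (N # u @ E # v))"
    unfolding valley_sum_def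
    by (subst sum.reindex_bij_betw[OF bij_betw_first_return, symmetric]) (simp add: split_def)
  also have "\<dots> = (\<Sum>i\<le>n. \<Sum>(u, v)\<in>{u. dyck_path i u} \<times> {v. dyck_path (n - i) v}.
        2 ^ valleys (N # u @ E # v))"
    by (subst sum.Sigma) (auto simp: finite_dyck_paths)
  also have "\<dots> = (\<Sum>i\<le>n. (if i = n then 1 else 2) * (valley_sum i * valley_sum (n - i)))"
    by (intro sum.cong inner) auto
  \<comment> \<open>The term \<open>i = n\<close>, where \<open>v\<close> is empty, has factor 1;
    since \<open>valley_sum 0 = 1\<close> it becomes the separate summand.\<close>
  also have "\<dots> = valley_sum n + 2 * (\<Sum>i<n. valley_sum i * valley_sum (n - i))"
    by (simp flip: lessThan_Suc_atMost add: valley_sum_0 sum_distrib_left)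
  finally show ?thesis .
qed

section \<open>Parking functions and descent words\<close>

text \<open>With \<open>y \<le> x\<close> an entry is the exact negation of \<open>x < y\<close>,
  the condition on the labels of consecutive north steps.\<close>

fun des :: "nat list \<Rightarrow> bool list" where
  "des (x # y # xs) = (y \<le> x) # des (y # xs)"
| "des _ = []"

lemma length_des: "length (des xs) = length xs - 1"
  by (induction xs rule: des.induct) auto

lemma path_labels_eqD:
  "map step_of p = map step_of q \<Longrightarrow> labels p = labels q \<Longrightarrow> p = q"
proof (induction p arbitrary: q)
  case (Cons s p)
  then obtain t q' where "q = t # q'"
    by (cases q) auto
  with Cons show ?case
    by (cases s; cases t) auto
qed simp

lemma ex_labelled_path:
  "length xs = count_list w N \<Longrightarrow> \<exists>p. map step_of p = w \<and> labels p = xs"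
proof (induction w arbitrary: xs)
  case (Cons s w)
  show ?case
  proof (cases s)
    case N
    with Cons.prems obtain x xs' where xs: "xs = x # xs'" "length xs' = count_list w N"
      by (cases xs) auto
    with Cons.IH obtain p where "map step_of p = w" "labels p = xs'"
      by blast
    with N xs show ?thesis
      by (intro exI[of _ "North x # p"]) simp
  next
    case E
    with Cons obtain p where "map step_of p = w" "labels p = xs"
      by fastforce
    with E show ?thesis
      by (intro exI[of _ "East # p"]) simp
  qed
qed simp

text \<open>The label condition as a relation between neighbouring steps, so that
  \<open>successively\<close> recurses along the path.\<close>

definition increasing_step :: "labelled_step \<Rightarrow> labelled_step \<Rightarrow> bool" where
  "increasing_step s t \<longleftrightarrow> (\<forall>a b. s = North a \<longrightarrow> t = North b \<longrightarrow> a < b)"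

text \<open>The second part keeps track of the last label \<open>x\<close> seen before an \<open>E\<close> step.\<close>

lemma successively_increasing_iff:
  "(successively increasing_step (North x # p) \<longleftrightarrow>
      list_all2 (\<longrightarrow>) (des (x # labels p)) (gaps (N # map step_of p))) \<and>
   (successively increasing_step (East # p) \<longleftrightarrow>
      list_all2 (\<longrightarrow>) (des (x # labels p)) (gaps (E # map step_of p)))"
proof (induction p arbitrary: x)
  case (Cons s p)
  then show ?case
    by (cases s) (auto simp: increasing_step_def)
qed simp

lemma parking_function_iff:
  assumes "n \<ge> 1"
  shows "parking_function n p \<longleftrightarrow> dyck_path n (map step_of p) \<and>
     distinct (labels p) \<and> set (labels p) = {1..n} \<and>
     list_all2 (\<longrightarrow>) (des (labels p)) (gaps (map step_of p))"
proof (cases "dyck_path n (map step_of p)")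
  case True
  \<comment> \<open>A nonempty Dyck path begins with a north step; its label is the first "last
    label seen".\<close>
  then obtain x q where "p = North x # q"
    using assms by (cases p; cases "hd p") (auto simp: dyck_path_iff)
  then have "successively increasing_step p \<longleftrightarrow>
      list_all2 (\<longrightarrow>) (des (labels p)) (gaps (map step_of p))"
    using successively_increasing_iff by simp
  then show ?thesis
    unfolding parking_function_def
    by (auto simp: successively_conv_nth increasing_step_def)
qed (simp add: parking_function_def)

text \<open>An entry of \<open>bs\<close> is free where \<open>gs\<close> has \<open>True\<close>
  and is forced to be \<open>False\<close> elsewhere.\<close>

lemma card_list_all2_imp: "card {bs. list_all2 (\<longrightarrow>) bs gs} = 2 ^ count_list gs True"
proof (induction gs)
  case (Cons g gs)
  have *: "{bs. list_all2 (\<longrightarrow>) bs (g # gs)} =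
      (\<lambda>(b, bs). b # bs) ` ({b. b \<longrightarrow> g} \<times> {bs. list_all2 (\<longrightarrow>) bs gs})"
    by (auto simp: list_all2_Cons2)
  have "{b. b \<longrightarrow> g} = (if g then {False, True} else {False})"
    by auto
  then have "card {b. b \<longrightarrow> g} = (if g then 2 else 1)"
    by simp
  with Cons show ?case
    by (subst *, subst card_image) (auto simp: inj_on_def card_cartesian_product)
qed simp

text \<open>The set of entries is arbitrary, so that deleting the first entry leaves an object of
  the same kind.\<close>

definition avoiders :: "nat set \<Rightarrow> nat list set \<Rightarrow> nat list set" where
  "avoiders A R = {xs. distinct xs \<and> set xs = A \<and> (\<forall>\<rho>\<in>R. avoids xs \<rho>)}"

lemma length_gaps: "length (gaps (N # w)) = count_list w N \<and> length (gaps (E # w)) = count_list w N"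
proof (induction w)
  case (Cons s w)
  then show ?case by (cases s) auto
qed simp

text \<open>For a fixed path \<open>w\<close>, \<open>des\<close> matches the fitting label words
  with the Boolean words below \<open>gaps w\<close>: a free choice of ascent or descent at each
  valley.\<close>

lemma pf_eq_valley_sum:
  assumes "n \<ge> 1" and bij: "bij_betw des (avoiders {1..n} R) {bs. length bs = n - 1}"
  shows "pf n R = valley_sum n"
proof -
  let ?V = "\<lambda>w. {xs \<in> avoiders {1..n} R. list_all2 (\<longrightarrow>) (des xs) (gaps w)}"
  have "bij_betw (\<lambda>p. (map step_of p, labels p))
      {p. parking_function n p \<and> (\<forall>\<rho>\<in>R. avoids (labels p) \<rho>)} (SIGMA w:{w. dyck_path n w}. ?V w)"
    (is "bij_betw ?f ?P ?S")
  proof (intro bij_betw_imageI)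
    show "inj_on ?f ?P"
      using path_labels_eqD by (auto simp: inj_on_def)
    show "?f ` ?P = ?S"
    proof (intro subset_antisym subsetI)
      fix z assume "z \<in> ?S"
      then obtain w xs where z: "z = (w, xs)" "dyck_path n w" "xs \<in> ?V w"
        by auto
      then have "length xs = count_list w N"
        using distinct_card[of xs] by (auto simp: avoiders_def dyck_path_def)
      then obtain p where "map step_of p = w" "labels p = xs"
        using ex_labelled_path by blast
      then show "z \<in> ?f ` ?P"
        using z assms(1) by (auto simp: parking_function_iff avoiders_def)
    qed (use assms(1) in \<open>auto simp: parking_function_iff avoiders_def\<close>)
  qed
  then have "pf n R = card (SIGMA w:{w. dyck_path n w}. ?V w)"
    by (simp add: pf_def bij_betw_same_card)
  also have "\<dots> = (\<Sum>w | dyck_path n w. card (?V w))"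
  proof (rule card_SigmaI)
    have "finite (avoiders {1..n} R)"
      using bij_betw_finite[OF bij] finite_lists_length_eq[of "UNIV :: bool set"] by simp
    then show "\<forall>w\<in>{w. dyck_path n w}. finite (?V w)"
      by simp
  qed (rule finite_dyck_paths)
  also have "\<dots> = valley_sum n"
    unfolding valley_sum_def
  proof (intro sum.cong refl)
    fix w assume "w \<in> {w. dyck_path n w}"
    then have "length (gaps w) = n - 1"
      using assms(1) length_gaps[of "tl w"]
      by (cases w; cases "hd w") (auto simp: dyck_path_iff)
    \<comment> \<open>Such a Boolean word has the length \<open>n - 1\<close> of
      \<open>gaps w\<close>, hence is the descent word of some avoider.\<close>
    then have "{bs. list_all2 (\<longrightarrow>) bs (gaps w)} \<subseteq> des ` avoiders {1..n} R"
      using bij by (auto simp: bij_betw_def dest: list_all2_lengthD)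
    then have "bij_betw des (?V w) {bs. list_all2 (\<longrightarrow>) bs (gaps w)}"
      using bij by (auto simp: bij_betw_def inj_on_def)
    then show "card (?V w) = 2 ^ valleys w"
      by (simp add: bij_betw_same_card card_list_all2_imp)
  qed
  finally show ?thesis .
qed

section \<open>Descent words of the four avoidance classes\<close>

text \<open>An arbitrary predicate covers one pattern, two patterns joined by a disjunction, and
  reversed patterns alike.\<close>

definition occurs3 :: "('a \<Rightarrow> 'a \<Rightarrow> 'a \<Rightarrow> bool) \<Rightarrow> 'a list \<Rightarrow> bool" where
  "occurs3 P xs \<longleftrightarrow> (\<exists>i j k. i < j \<and> j < k \<and> k < length xs \<and> P (xs ! i) (xs ! j) (xs ! k))"

text \<open>Six comparisons suffice, as comparing an entry with itself is true on both
  sides.\<close>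

lemma contains_3_iff:
  "contains xs [a, b, c] \<longleftrightarrow>
     occurs3 (\<lambda>x y z. (x \<le> y \<longleftrightarrow> a \<le> b) \<and> (y \<le> x \<longleftrightarrow> b \<le> a) \<and> (x \<le> z \<longleftrightarrow> a \<le> c) \<and>
       (z \<le> x \<longleftrightarrow> c \<le> a) \<and> (y \<le> z \<longleftrightarrow> b \<le> c) \<and> (z \<le> y \<longleftrightarrow> c \<le> b)) xs" (is "_ \<longleftrightarrow> ?R")
proof
  assume "contains xs [a, b, c]"
  then obtain f where mono: "strict_mono_on {..<3::nat} f" and len: "\<forall>i<3. f i < length xs"
    and ord: "\<And>i j. i < 3 \<Longrightarrow> j < 3 \<Longrightarrow> xs ! f i \<le> xs ! f j \<longleftrightarrow> [a, b, c] ! i \<le> [a, b, c] ! j"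
    by (auto simp: contains_def numeral_3_eq_3)
  have "f 0 < f 1" "f 1 < f 2"
    using mono by (auto intro: strict_mono_onD)
  moreover have "f 2 < length xs"
    using len by simp
  ultimately show ?R
    using ord[of 0 1] ord[of 1 0] ord[of 0 2] ord[of 2 0] ord[of 1 2] ord[of 2 1]
    unfolding occurs3_def by (intro exI[of _ "f 0"] exI[of _ "f 1"] exI[of _ "f 2"]) simp
next
  assume ?R
  then obtain i j k where ijk: "i < j" "j < k" "k < length xs" and ord:
    "(xs ! i \<le> xs ! j \<longleftrightarrow> a \<le> b) \<and> (xs ! j \<le> xs ! i \<longleftrightarrow> b \<le> a) \<and> (xs ! i \<le> xs ! k \<longleftrightarrow> a \<le> c) \<and>
     (xs ! k \<le> xs ! i \<longleftrightarrow> c \<le> a) \<and> (xs ! j \<le> xs ! k \<longleftrightarrow> b \<le> c) \<and> (xs ! k \<le> xs ! j \<longleftrightarrow> c \<le> b)"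
    unfolding occurs3_def by blast
  have less3: "m < 3 \<longleftrightarrow> m = 0 \<or> m = 1 \<or> m = 2" for m :: nat
    by auto
  have "strict_mono_on {..<3} ((!) [i, j, k])"
    using ijk by (auto simp: strict_mono_on_def less3)
  moreover have "\<forall>m<3. [i, j, k] ! m < length xs"
    using ijk by (auto simp: less3)
  moreover have "\<forall>m<3. \<forall>l<3. xs ! ([i, j, k] ! m) \<le> xs ! ([i, j, k] ! l) \<longleftrightarrow>
      [a, b, c] ! m \<le> [a, b, c] ! l"
    using ord by (auto simp: less3)
  ultimately show "contains xs [a, b, c]"
    unfolding contains_def by (intro exI[of _ "(!) [i, j, k]"]) (simp add: numeral_3_eq_3)
qed

lemma occurs3_Nil: "\<not> occurs3 P []"
  by (simp add: occurs3_def)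

lemma occurs3_Cons:
  "occurs3 P (x # xs) \<longleftrightarrow>
     occurs3 P xs \<or> (\<exists>j k. j < k \<and> k < length xs \<and> P x (xs ! j) (xs ! k))" (is "?L \<longleftrightarrow> ?R")
proof
  assume ?L
  then obtain i j k where ijk: "i < j" "j < k" "k < Suc (length xs)"
    "P ((x # xs) ! i) ((x # xs) ! j) ((x # xs) ! k)"
    by (auto simp: occurs3_def)
  then obtain j' k' where "j = Suc j'" "k = Suc k'"
    by (metis Suc_lessE not0_implies_Suc not_less0)
  with ijk show ?R
    by (cases i) (auto simp: occurs3_def)
next
  assume ?R
  then show ?L
  proof (elim disjE exE conjE)
    assume "occurs3 P xs"
    then obtain i j k where "i < j" "j < k" "k < length xs" "P (xs ! i) (xs ! j) (xs ! k)"
      by (auto simp: occurs3_def)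
    then show ?L
      unfolding occurs3_def by (intro exI[of _ "Suc i"] exI[of _ "Suc j"] exI[of _ "Suc k"]) simp
  next
    fix j k assume "j < k" "k < length xs" "P x (xs ! j) (xs ! k)"
    then show ?L
      unfolding occurs3_def by (intro exI[of _ 0] exI[of _ "Suc j"] exI[of _ "Suc k"]) simp
  qed
qed

lemma occurs3_revI: "occurs3 (\<lambda>x y z. P z y x) xs \<Longrightarrow> occurs3 P (rev xs)"
proof -
  assume "occurs3 (\<lambda>x y z. P z y x) xs"
  then obtain i j k where ijk: "i < j" "j < k" "k < length xs" "P (xs ! k) (xs ! j) (xs ! i)"
    by (auto simp: occurs3_def)
  let ?r = "\<lambda>i. length xs - Suc i"
  have "?r k < ?r j" "?r j < ?r i" "?r i < length xs"
    using ijk by auto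
  moreover have "rev xs ! ?r k = xs ! k" "rev xs ! ?r j = xs ! j" "rev xs ! ?r i = xs ! i"
    using ijk by (auto simp: rev_nth)
  ultimately show ?thesis
    using ijk(4) unfolding occurs3_def
    by (intro exI[of _ "?r k"] exI[of _ "?r j"] exI[of _ "?r i"]) simp
qed

lemma occurs3_rev: "occurs3 P (rev xs) \<longleftrightarrow> occurs3 (\<lambda>x y z. P z y x) xs"
  using occurs3_revI[of P xs] occurs3_revI[of "\<lambda>x y z. P z y x" "rev xs"] by auto

lemma contains_rev_3: "contains (rev xs) [a, b, c] \<longleftrightarrow> contains xs [c, b, a]"
  unfolding contains_3_iff occurs3_rev by (rule arg_cong[of _ _ "\<lambda>P. occurs3 P xs"]) (auto simp: fun_eq_iff)

section \<open>Reversal, and the scheme common to both basic classes\<close>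

lemma des_snoc: "xs \<noteq> [] \<Longrightarrow> des (xs @ [y]) = des xs @ [y \<le> last xs]"
  by (induction xs rule: des.induct) auto

text \<open>Distinctness excludes ties, so a descent read backwards is an ascent.\<close>

lemma des_rev: "distinct xs \<Longrightarrow> des (rev xs) = rev (map Not (des xs))"
proof (induction xs rule: des.induct)
  case (1 x y xs)
  then show ?case
    using des_snoc[of "rev (y # xs)" x] by auto
qed auto

lemma avoiders_rev:
  "avoiders A {[c, b, a], [f, e, d]} = rev ` avoiders A {[a, b, c], [d, e, f]}"
proof (intro set_eqI iffI)
  fix xs assume "xs \<in> avoiders A {[c, b, a], [f, e, d]}"
  then show "xs \<in> rev ` avoiders A {[a, b, c], [d, e, f]}"
    by (intro image_eqI[of _ _ "rev xs"]) (auto simp: avoiders_def contains_rev_3)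
qed (auto simp: avoiders_def contains_rev_3)

text \<open>On descent words, reversal of permutations acts as reversing and negating, an involution
  of the Boolean words of length \<open>m\<close>.\<close>

lemma bij_betw_des_avoiders_rev:
  assumes "bij_betw des (avoiders A {[a, b, c], [d, e, f]}) {bs. length bs = m}"
  shows "bij_betw des (avoiders A {[c, b, a], [f, e, d]}) {bs. length bs = m}"
proof -
  let ?S = "avoiders A {[a, b, c], [d, e, f]}" and ?L = "{bs :: bool list. length bs = m}"
  have "rev (map Not (rev (map Not bs))) = bs" for bs
    by (simp add: rev_map[symmetric] comp_def)
  then have "bij_betw (\<lambda>bs. rev (map Not bs)) ?L ?L"
    by (intro bij_betw_byWitness[where f' = "\<lambda>bs. rev (map Not bs)"]) auto
  with assms have "bij_betw ((\<lambda>bs. rev (map Not bs)) \<circ> des) ?S ?L"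
    by (rule bij_betw_trans)
  moreover have "((\<lambda>bs. rev (map Not bs)) \<circ> des) xs = (des \<circ> rev) xs" if "xs \<in> ?S" for xs
    using that by (simp add: avoiders_def des_rev)
  ultimately have "bij_betw (des \<circ> rev) ?S ?L"
    by (simp cong: bij_betw_cong)
  moreover have "bij_betw rev ?S (rev ` ?S)"
    by (simp add: inj_on_imp_bij_betw)
  ultimately show ?thesis
    using bij_betw_comp_iff avoiders_rev by metis
qed

lemma occurs3_disj: "occurs3 (\<lambda>x y z. P x y z \<or> Q x y z) xs \<longleftrightarrow> occurs3 P xs \<or> occurs3 Q xs"
  unfolding occurs3_def by blast

lemma contains_213: "contains xs [2,1,3] \<longleftrightarrow> occurs3 (\<lambda>x y z. y < x \<and> x < z) xs"
  and contains_231: "contains xs [2,3,1] \<longleftrightarrow> occurs3 (\<lambda>x y z. z < x \<and> x < y) xs"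
  and contains_132: "contains xs [1,3,2] \<longleftrightarrow> occurs3 (\<lambda>x y z. x < z \<and> z < y) xs"
  unfolding contains_3_iff
  by (rule arg_cong[of _ _ "\<lambda>P. occurs3 P xs"], force simp: fun_eq_iff)+

lemma avoiders_213_231:
  "avoiders A {[2,1,3], [2,3,1]} =
     {xs. distinct xs \<and> set xs = A \<and> \<not> occurs3 (\<lambda>x y z. y < x \<and> x < z \<or> z < x \<and> x < y) xs}"
  unfolding avoiders_def occurs3_disj ball_simps contains_213 contains_231 by simp

lemma avoiders_132_213:
  "avoiders A {[1,3,2], [2,1,3]} =
     {xs. distinct xs \<and> set xs = A \<and> \<not> occurs3 (\<lambda>x y z. x < z \<and> z < y \<or> y < x \<and> x < z) xs}"
  unfolding avoiders_def occurs3_disj ball_simps contains_213 contains_132 by simp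

lemma des_Cons: "xs \<noteq> [] \<Longrightarrow> des (x # xs) = (hd xs \<le> x) # des xs"
  by (cases xs) auto

text \<open>By \<open>head\<close>, a descent word \<open>b # bs\<close> fixes the first entry
  \<open>x\<close>, and what follows is any avoider on \<open>A - {x}\<close> with descent word
  \<open>bs\<close>. Induction on the descent word then gives exactly one preimage.\<close>

lemma bij_betw_des_avoiders:
  assumes head: "\<And>A b bs. finite A \<Longrightarrow> card A = Suc (Suc (length bs)) \<Longrightarrow>
      \<exists>x\<in>A. \<forall>ys. ys \<in> avoiders A R \<and> des ys = b # bs \<longleftrightarrow>
        (\<exists>xs. ys = x # xs \<and> xs \<in> avoiders (A - {x}) R \<and> des xs = bs)"
    and sing: "\<And>x. [x] \<in> avoiders {x} R"
    and A: "finite A" "A \<noteq> {}"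
  shows "bij_betw des (avoiders A R) {bs. length bs = card A - 1}"
proof -
  have unique: "\<exists>!xs. xs \<in> avoiders A R \<and> des xs = bs"
    if "finite A" "card A = Suc (length bs)" for A bs
    using that
  proof (induction bs arbitrary: A)
    case Nil
    then obtain x where "A = {x}"
      by (metis One_nat_def card_1_singletonE list.size(3))
    moreover have "xs = [x]" if "distinct xs" "set xs = {x}" for xs
      using that by (cases xs; cases "tl xs") auto
    ultimately show ?case
      using sing by (intro ex1I[of _ "[x]"]) (auto simp: avoiders_def)
  next
    case (Cons b bs)
    then obtain x where x: "x \<in> A" and iff: "\<And>ys. ys \<in> avoiders A R \<and> des ys = b # bs \<longleftrightarrow>
        (\<exists>xs. ys = x # xs \<and> xs \<in> avoiders (A - {x}) R \<and> des xs = bs)"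
      using head[of A bs b] by auto
    have "\<exists>!xs. xs \<in> avoiders (A - {x}) R \<and> des xs = bs"
      using Cons x by simp
    then show ?case
      unfolding iff by blast
  qed
  have "length (des xs) = card A - 1" if "xs \<in> avoiders A R" for xs
    using that distinct_card[of xs] by (auto simp: avoiders_def length_des)
  moreover have "\<exists>!xs. xs \<in> avoiders A R \<and> des xs = bs" if "length bs = card A - 1" for bs
    using that A card_gt_0_iff[of A] by (intro unique) auto
  ultimately show ?thesis
    unfolding bij_betw_def inj_on_def by (auto simp: image_iff) metis+
qed

section \<open>The class avoiding 213 and 231\<close>

text \<open>If both a smaller and a larger entry follow \<open>x\<close>, then \<open>x\<close>
  starts a 213 or a 231, depending on which of them comes first.\<close>

lemma Cons_avoiders_213_231:
  "x # xs \<in> avoiders A {[2,1,3], [2,3,1]} \<longleftrightarrow>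
     x \<in> A \<and> xs \<in> avoiders (A - {x}) {[2,1,3], [2,3,1]} \<and>
     ((\<forall>y\<in>set xs. x < y) \<or> (\<forall>y\<in>set xs. y < x))"
proof -
  let ?P = "\<lambda>x y z. y < x \<and> x < z \<or> z < x \<and> x < (y :: nat)"
  have "(\<exists>j k. j < k \<and> k < length xs \<and> ?P x (xs ! j) (xs ! k)) \<longleftrightarrow>
      \<not> ((\<forall>y\<in>set xs. x < y) \<or> (\<forall>y\<in>set xs. y < x))" (is "?L \<longleftrightarrow> \<not> ?R") if x: "x \<notin> set xs"
  proof (intro iffI notI)
    assume ?L ?R
    then obtain j k where jk: "j < k" "k < length xs" "?P x (xs ! j) (xs ! k)"
      by blast
    then have "xs ! j \<in> set xs" "xs ! k \<in> set xs"
      by auto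
    with \<open>?R\<close> jk(3) show False
      by (meson less_asym)
  next
    assume "\<not> ?R"
    then have "\<exists>y\<in>set xs. y < x" "\<exists>z\<in>set xs. x < z"
      using x by (metis nat_neq_iff)+
    then obtain j k where jk: "j < length xs" "k < length xs" "xs ! j < x" "x < xs ! k"
      by (auto simp: in_set_conv_nth)
    then have "j \<noteq> k"
      by (metis less_asym)
    then show ?L
      using jk by (metis nat_neq_iff)
  qed
  then show ?thesis
    unfolding avoiders_213_231 occurs3_Cons mem_Collect_eq by auto
qed

lemma bij_betw_des_213_231:
  assumes "finite A" "A \<noteq> {}"
  shows "bij_betw des (avoiders A {[2,1,3], [2,3,1]}) {bs. length bs = card A - 1}"
proof (intro bij_betw_des_avoiders assms)
  fix A :: "nat set" and b and bs :: "bool list" assume A: "finite A" "card A = Suc (Suc (length bs))"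
  \<comment> \<open>A descent at the first place forces the greatest element to come first, an
    ascent the least.\<close>
  define m where "m = (if b then Max A else Min A)"
  \<comment> \<open>\<open>A\<close> has at least two elements, so entries remain after
    \<open>x\<close> and \<open>hd xs\<close> is a genuine one.\<close>
  have nonempty: "xs \<noteq> []" if "xs \<in> avoiders (A - {x}) R" "x \<in> A" for x xs R
    using that A by (auto simp: avoiders_def dest!: arg_cong[of _ _ card])
  have "A \<noteq> {}"
    using A by auto
  show "\<exists>x\<in>A. \<forall>ys. ys \<in> avoiders A {[2,1,3], [2,3,1]} \<and> des ys = b # bs \<longleftrightarrow>
      (\<exists>xs. ys = x # xs \<and> xs \<in> avoiders (A - {x}) {[2,1,3], [2,3,1]} \<and> des xs = bs)"
  proof (intro bexI allI iffI)
    show "m \<in> A"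
      using A \<open>A \<noteq> {}\<close> by (simp add: m_def)
  next
    fix ys assume ys: "ys \<in> avoiders A {[2,1,3], [2,3,1]} \<and> des ys = b # bs"
    then obtain x xs where x: "ys = x # xs"
      by (cases ys) auto
    then have xs: "x \<in> A" "xs \<in> avoiders (A - {x}) {[2,1,3], [2,3,1]}"
      "(\<forall>y\<in>set xs. x < y) \<or> (\<forall>y\<in>set xs. y < x)"
      using ys Cons_avoiders_213_231 by auto
    then have "xs \<noteq> []"
      by (intro nonempty)
    then have b: "b \<longleftrightarrow> hd xs \<le> x" "des xs = bs"
      using ys x by (auto simp: des_Cons)
    have set: "set xs = A - {x}"
      using xs by (simp add: avoiders_def)
    have hd: "hd xs \<in> set xs"
      using \<open>xs \<noteq> []\<close> by simp
    \<comment> \<open>As \<open>x\<close> is extreme, its comparison with the single entry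
      \<open>hd xs\<close> decides which extreme it is.\<close>
    from xs(3) have "\<forall>y\<in>set xs. if b then y < x else x < y"
    proof (elim disjE)
      assume *: "\<forall>y\<in>set xs. x < y"
      then have "\<not> b"
        using hd b(1) by (simp add: not_le)
      with * show ?thesis by simp
    next
      assume *: "\<forall>y\<in>set xs. y < x"
      then have b
        using hd b(1) by (simp add: less_imp_le)
      with * show ?thesis by simp
    qed
    then have "\<forall>y\<in>A - {x}. if b then y < x else x < y"
      unfolding set .
    then have "m = x"
      using A xs(1) unfolding m_def
      by (auto intro!: Max_eqI Min_eqI split: if_splits) (metis Diff_iff less_imp_le order_refl singletonD)+
    then show "\<exists>xs. ys = m # xs \<and> xs \<in> avoiders (A - {m}) {[2,1,3], [2,3,1]} \<and> des xs = bs"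
      using x xs b by auto
  next
    fix ys assume "\<exists>xs. ys = m # xs \<and> xs \<in> avoiders (A - {m}) {[2,1,3], [2,3,1]} \<and> des xs = bs"
    then obtain xs where xs: "ys = m # xs" "xs \<in> avoiders (A - {m}) {[2,1,3], [2,3,1]}" "des xs = bs"
      by auto
    have "m \<in> A"
      using A \<open>A \<noteq> {}\<close> by (simp add: m_def)
    then have "xs \<noteq> []"
      using xs nonempty by auto
    have set: "set xs = A - {m}"
      using xs by (simp add: avoiders_def)
    have "\<forall>y\<in>set xs. if b then y < m else m < y"
      using A unfolding set m_def by (auto simp: le_neq_implies_less)
    then have "(\<forall>y\<in>set xs. m < y) \<or> (\<forall>y\<in>set xs. y < m)" "hd xs \<le> m \<longleftrightarrow> b"
      using hd_in_set[OF \<open>xs \<noteq> []\<close>] by (auto split: if_splits simp: not_le)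
    then show "ys \<in> avoiders A {[2,1,3], [2,3,1]} \<and> des ys = b # bs"
      using xs(2,3) \<open>m \<in> A\<close> \<open>xs \<noteq> []\<close>
      unfolding xs(1) Cons_avoiders_213_231 by (simp add: des_Cons)
  qed
qed (unfold avoiders_213_231, simp add: occurs3_Cons occurs3_Nil)

section \<open>The class avoiding 132 and 213\<close>

text \<open>Only \<open>hd xs\<close> need be examined as second entry of a pattern starting at
  \<open>x\<close>: any other such pattern yields one inside \<open>xs\<close> starting at
  \<open>hd xs\<close>. For empty \<open>xs\<close> the first alternative holds, whatever
  \<open>hd []\<close> is.\<close>

lemma Cons_avoiders_132_213:
  "x # xs \<in> avoiders A {[1,3,2], [2,1,3]} \<longleftrightarrow>
     x \<in> A \<and> xs \<in> avoiders (A - {x}) {[1,3,2], [2,1,3]} \<and>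
     ((\<forall>y\<in>set xs. y < x) \<or> x < hd xs \<and> (\<forall>y\<in>set xs. \<not> (x < y \<and> y < hd xs)))"
proof -
  let ?P = "\<lambda>x y z. x < z \<and> z < y \<or> y < x \<and> x < (z :: nat)"
  have "(\<exists>j k. j < k \<and> k < length xs \<and> ?P x (xs ! j) (xs ! k)) \<longleftrightarrow>
      \<not> ((\<forall>y\<in>set xs. y < x) \<or> x < hd xs \<and> (\<forall>y\<in>set xs. \<not> (x < y \<and> y < hd xs)))" (is "?L \<longleftrightarrow> \<not> ?R")
    if dist: "x \<notin> set xs" "distinct xs" and avoid: "\<not> occurs3 ?P xs"
  proof (intro iffI notI)
    assume ?L ?R
    then obtain j k where jk: "j < k" "k < length xs" "?P x (xs ! j) (xs ! k)"
      by blast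
    then have mem: "xs ! j \<in> set xs" "xs ! k \<in> set xs"
      by auto
    have "xs \<noteq> []"
      using jk(2) by auto
    then have hd: "hd xs = xs ! 0"
      by (rule hd_conv_nth)
    have "\<not> (\<forall>y\<in>set xs. y < x)"
      using jk(3) mem by (meson less_asym)
    with \<open>?R\<close> have R: "x < hd xs" "\<not> (x < xs ! j \<and> xs ! j < hd xs)" "\<not> (x < xs ! k \<and> xs ! k < hd xs)"
      using mem by auto
    have "xs ! k \<noteq> xs ! 0"
      using nth_eq_iff_index_eq[OF dist(2) jk(2), of 0] jk(1) \<open>xs \<noteq> []\<close> by auto
    \<comment> \<open>No entry of \<open>xs\<close> lies strictly between \<open>x\<close> and
      \<open>hd xs\<close>, so \<open>hd xs\<close> can replace \<open>x\<close> in the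
      pattern.\<close>
    then have "?P (xs ! 0) (xs ! j) (xs ! k)"
      using R jk(3) unfolding hd by auto
    moreover from this have "j \<noteq> 0"
      by (metis less_asym less_irrefl)
    ultimately show False
      using avoid jk unfolding occurs3_def by blast
  next
    assume R: "\<not> ?R"
    then obtain y where y: "y \<in> set xs" "x < y"
      using dist by (metis nat_neq_iff)
    have nth: "\<exists>k. k < length xs \<and> xs ! k = z" if "z \<in> set xs" for z
      using that by (simp add: in_set_conv_nth)
    have "xs \<noteq> []"
      using y by auto
    then have hd: "hd xs = xs ! 0" "hd xs \<in> set xs"
      by (simp_all add: hd_conv_nth)
    \<comment> \<open>If \<open>hd xs < x\<close>, the larger entry \<open>y\<close> completes a
      213; otherwise an entry strictly between \<open>x\<close> and \<open>hd xs\<close> completes a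
      132.\<close>
    have "\<exists>z\<in>set xs. ?P x (hd xs) z"
      using R y hd dist by (metis nat_neq_iff)
    then obtain k where k: "k < length xs" "?P x (xs ! 0) (xs ! k)"
      using nth hd by metis
    then have "0 < k"
      by (cases k) auto
    with k show ?L
      by blast
  qed
  then show ?thesis
    unfolding avoiders_132_213 occurs3_Cons mem_Collect_eq by auto
qed

text \<open>The first entry ends up as many places below the maximum as there are initial ascents, because
  each of these ascents goes to the next larger entry.\<close>

lemma card_greater_hd:
  assumes "xs \<in> avoiders A {[1,3,2], [2,1,3]}" "xs \<noteq> []"
  shows "card {y \<in> A. hd xs < y} = length (takeWhile Not (des xs))"
  using assms
proof (induction xs arbitrary: A)
  case (Cons x xs)
  then have xs: "x \<in> A" "xs \<in> avoiders (A - {x}) {[1,3,2], [2,1,3]}"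
    "(\<forall>y\<in>set xs. y < x) \<or> x < hd xs \<and> (\<forall>y\<in>set xs. \<not> (x < y \<and> y < hd xs))"
    unfolding Cons_avoiders_132_213 by blast+
  have A: "A = insert x (set xs)" "x \<notin> set xs"
    using Cons.prems by (auto simp: avoiders_def)
  show ?case
  proof (cases "xs = []")
    case True
    then show ?thesis using A by simp
  next
    case False
    show ?thesis
    proof (cases "\<forall>y\<in>set xs. y < x")
      case True
      then have "{y \<in> A. x < y} = {}" "hd xs \<le> x"
        using A \<open>xs \<noteq> []\<close> by (auto dest: less_imp_le)
      then have "card {y \<in> A. x < y} = 0"
        by (simp only: card.empty)
      then show ?thesis
        using \<open>hd xs \<le> x\<close> \<open>xs \<noteq> []\<close> by (simp add: des_Cons)
    next
      case False
      then have *: "x < hd xs" "\<And>y. y \<in> set xs \<Longrightarrow> \<not> (x < y \<and> y < hd xs)"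
        using xs(3) by auto
      then have "{y \<in> A. x < y} = insert (hd xs) {y \<in> A - {x}. hd xs < y}"
        using A hd_in_set[OF \<open>xs \<noteq> []\<close>] by (auto simp: not_less) (metis leD le_neq_implies_less)
      moreover have "finite A"
        using A by simp
      ultimately show ?thesis
        using Cons.IH[OF xs(2) \<open>xs \<noteq> []\<close>] * \<open>xs \<noteq> []\<close> by (simp add: des_Cons)
    qed
  qed
qed simp

text \<open>The number of larger elements strictly decreases along \<open>A\<close>, so it is an
  injection into \<open>{..<card A}\<close>, hence onto it.\<close>

lemma ex1_card_greater:
  assumes "finite A" "j < card A"
  shows "\<exists>!x. x \<in> A \<and> card {y \<in> A. x < (y :: nat)} = j"
proof -
  let ?r = "\<lambda>x. card {y \<in> A. x < y}"
  have less: "?r y < ?r x" if "x \<in> A" "y \<in> A" "x < y" for x y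
  proof -
    have "card (insert y {z \<in> A. y < z}) \<le> ?r x"
      using that assms(1) by (intro card_mono) auto
    then show ?thesis
      using assms(1) by simp
  qed
  have "inj_on ?r A"
  proof (rule linorder_inj_onI)
    show "?r x \<noteq> ?r y" if "x < y" "x \<in> A" "y \<in> A" for x y
      using less[OF that(2,3,1)] by simp
  qed auto
  moreover have "?r ` A \<subseteq> {..<card A}"
  proof (intro image_subsetI)
    fix x assume "x \<in> A"
    then have "{y \<in> A. x < y} \<subset> A"
      by blast
    then show "?r x \<in> {..<card A}"
      using assms(1) by (auto intro: psubset_card_mono)
  qed
  ultimately have "?r ` A = {..<card A}"
    using assms(1) by (intro card_subset_eq) (simp_all add: card_image)
  then have "j \<in> ?r ` A"
    using assms(2) by simp
  then obtain x where x: "x \<in> A" "?r x = j"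
    by blast
  show ?thesis
  proof (rule ex1I)
    show "x \<in> A \<and> ?r x = j"
      using x by simp
    show "y = x" if "y \<in> A \<and> ?r y = j" for y
      using that x inj_onD[OF \<open>inj_on ?r A\<close>, of y x] by simp
  qed
qed

lemma bij_betw_des_132_213:
  assumes "finite A" "A \<noteq> {}"
  shows "bij_betw des (avoiders A {[1,3,2], [2,1,3]}) {bs. length bs = card A - 1}"
proof (intro bij_betw_des_avoiders assms)
  fix A :: "nat set" and b and bs :: "bool list" assume A: "finite A" "card A = Suc (Suc (length bs))"
  \<comment> \<open>The number of initial ascents of the prescribed word; by
    \<open>card_greater_hd\<close> the first entry must have exactly \<open>?j\<close> larger
    elements in \<open>A\<close>.\<close>
  let ?j = "length (takeWhile Not (b # bs))"
  have nonempty: "xs \<noteq> []" if "xs \<in> avoiders (A - {x}) R" "x \<in> A" for x xs R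
    using that A by (auto simp: avoiders_def dest!: arg_cong[of _ _ card])
  have "?j < card A"
    using length_takeWhile_le[of Not "b # bs"] A by simp
  then have ex1: "\<exists>!x. x \<in> A \<and> card {y \<in> A. x < y} = ?j"
    using A by (intro ex1_card_greater)
  then obtain m where m: "m \<in> A \<and> card {y \<in> A. m < y} = ?j"
    and unique: "\<forall>x. x \<in> A \<and> card {y \<in> A. x < y} = ?j \<longrightarrow> x = m"
    by (rule ex1E)
  note m = conjunct1[OF m] conjunct2[OF m]
  show "\<exists>x\<in>A. \<forall>ys. ys \<in> avoiders A {[1,3,2], [2,1,3]} \<and> des ys = b # bs \<longleftrightarrow>
      (\<exists>xs. ys = x # xs \<and> xs \<in> avoiders (A - {x}) {[1,3,2], [2,1,3]} \<and> des xs = bs)"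
  proof (intro bexI[OF _ m(1)] allI iffI)
    fix ys assume ys: "ys \<in> avoiders A {[1,3,2], [2,1,3]} \<and> des ys = b # bs"
    then obtain x xs where x: "ys = x # xs"
      by (cases ys) auto
    then have xs: "x \<in> A" "xs \<in> avoiders (A - {x}) {[1,3,2], [2,1,3]}"
      using ys Cons_avoiders_132_213 by blast+
    have "card {y \<in> A. x < y} = ?j"
      using card_greater_hd[of ys A] ys x by simp
    with xs(1) have "m = x"
      by (intro sym[OF unique[rule_format]] conjI)
    moreover have "des xs = bs"
      using ys x nonempty[OF xs(2,1)] by (simp add: des_Cons)
    ultimately show "\<exists>xs. ys = m # xs \<and> xs \<in> avoiders (A - {m}) {[1,3,2], [2,1,3]} \<and> des xs = bs"
      using x xs by auto
  next
    fix ys assume "\<exists>xs. ys = m # xs \<and> xs \<in> avoiders (A - {m}) {[1,3,2], [2,1,3]} \<and> des xs = bs"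
    then obtain xs where xs: "ys = m # xs" "xs \<in> avoiders (A - {m}) {[1,3,2], [2,1,3]}" "des xs = bs"
      by auto
    then have "xs \<noteq> []"
      using m nonempty by blast
    have set: "set xs = A - {m}"
      using xs by (simp add: avoiders_def)
    have h: "hd xs \<in> A" "hd xs \<noteq> m"
      using hd_in_set[OF \<open>xs \<noteq> []\<close>] set by auto
    have "((\<forall>y\<in>set xs. y < m) \<or> m < hd xs \<and> (\<forall>y\<in>set xs. \<not> (m < y \<and> y < hd xs))) \<and> (hd xs \<le> m \<longleftrightarrow> b)"
    proof (cases b)
      case True
      \<comment> \<open>An initial descent gives \<open>?j = 0\<close>, so \<open>m\<close> is the
        maximum.\<close>
      then have "{y \<in> A. m < y} = {}"
        using m A by simp
      then have "\<forall>y\<in>A - {m}. y < m"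
        by (metis (mono_tags, lifting) DiffE empty_Collect_eq nat_neq_iff singletonI)
      then show ?thesis
        using True set h by (auto simp: less_imp_le)
    next
      case False
      let ?G = "{y \<in> A. m < y}" and ?H = "{y \<in> A - {m}. hd xs < y}"
      \<comment> \<open>An initial ascent makes \<open>?j\<close> one more than the number of
        initial ascents of \<open>bs\<close>, and \<open>card_greater_hd\<close> for
        \<open>xs\<close> identifies the latter with \<open>card ?H\<close>.\<close>
      have card: "card ?G = Suc (card ?H)"
        using False m card_greater_hd[OF xs(2) \<open>xs \<noteq> []\<close>] xs(3) by simp
      have "m < hd xs"
      proof (rule ccontr)
        assume "\<not> m < hd xs"
        then have "?G \<subseteq> ?H"
          using h by auto
        then have "card ?G \<le> card ?H"
          using A by (intro card_mono) auto
        with card show False by simp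
      qed
      then have "insert (hd xs) ?H \<subseteq> ?G"
        using h by auto
      \<comment> \<open>Both sets have the same size, so the inclusion is an equality:
        \<open>hd xs\<close> is the next larger element after \<open>m\<close>.\<close>
      then have eq: "insert (hd xs) ?H = ?G"
        using A card by (intro card_subset_eq) auto
      have "y = hd xs \<or> hd xs < y" if "y \<in> set xs" "m < y" for y
      proof -
        have "y \<in> ?G"
          using that set by simp
        then show ?thesis
          unfolding eq[symmetric] by blast
      qed
      then have "\<forall>y\<in>set xs. \<not> (m < y \<and> y < hd xs)"
        by fastforce
      then show ?thesis
        using False \<open>m < hd xs\<close> by simp
    qed
    then show "ys \<in> avoiders A {[1,3,2], [2,1,3]} \<and> des ys = b # bs"
      using xs(2,3) m(1) \<open>xs \<noteq> []\<close>
      unfolding xs(1) Cons_avoiders_132_213 by (simp add: des_Cons)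
  qed
qed (unfold avoiders_132_213, simp add: occurs3_Cons occurs3_Nil)

section \<open>Equality of the four numbers and the recurrence\<close>

theorem theorem23:
  fixes n :: nat
  assumes "n \<ge> 1"
  shows "pf n {[1,3,2], [2,1,3]} = pf n {[1,3,2], [3,1,2]}
       \<and> pf n {[1,3,2], [3,1,2]} = pf n {[2,1,3], [2,3,1]}
       \<and> pf n {[2,1,3], [2,3,1]} = pf n {[2,3,1], [3,1,2]}
       \<and> pf n {[1,3,2], [2,1,3]} =
           pf (n - 1) {[1,3,2], [2,1,3]} +
           2 * (\<Sum>i = 1..n - 1. pf i {[1,3,2], [2,1,3]} * pf (n - i - 1) {[1,3,2], [2,1,3]})"
proof -
  let ?R = "{[1,3,2], [2,1,3]} :: nat list set"
  have bij1: "bij_betw des (avoiders {1..m} {[1,3,2], [2,1,3]}) {bs. length bs = m - 1}"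
    and bij2: "bij_betw des (avoiders {1..m} {[2,1,3], [2,3,1]}) {bs. length bs = m - 1}"
    if "m \<ge> 1" for m
    using bij_betw_des_132_213[of "{1..m}"] bij_betw_des_213_231[of "{1..m}"] that by auto
  \<comment> \<open>Reversal turns 132, 213 into 231, 312 and turns 213, 231 into 312, 132.\<close>
  have eq: "pf n ?R = valley_sum n" "pf n {[2,1,3], [2,3,1]} = valley_sum n"
    "pf n {[2,3,1], [3,1,2]} = valley_sum n" "pf n {[1,3,2], [3,1,2]} = valley_sum n"
    using assms bij1 bij2 bij_betw_des_avoiders_rev[OF bij1] bij_betw_des_avoiders_rev[OF bij2]
    by (simp_all only: pf_eq_valley_sum insert_commute)
  \<comment> \<open>Size 0 is treated apart, since it occurs in the recurrence when
    \<open>i = n - 1\<close>.\<close>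
  have R: "pf m ?R = valley_sum m" for m
    using bij1 by (cases "m = 0") (simp_all add: pf_0 valley_sum_0 pf_eq_valley_sum)
  obtain k where k: "n = Suc k"
    using assms by (cases n) auto
  \<comment> \<open>Exchanging the two factors moves the index range from \<open>0..k-1\<close> to
    \<open>1..k\<close>.\<close>
  have "(\<Sum>i<k. valley_sum i * valley_sum (k - i)) = (\<Sum>i = 1..k. valley_sum i * valley_sum (k - i))"
    by (rule sum.reindex_bij_witness[of _ "\<lambda>i. k - i" "\<lambda>i. k - i"]) auto
  then show ?thesis
    unfolding eq R by (simp add: k valley_sum_Suc)
qed

end
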